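(* Let $n\ge1$, $m\ge1$, and let $R$ and $R'$ be regions of the $n$-dimensional $m$-Catalan arrangement with Pak–Stanley labels $\mathbf a$ and $\mathbf b$ respectively. Then $\mathbf z(\mathbf a)=\mathbf z(\mathbf b)$ if and only if $R'=\pi(R)$ for some $\pi\in\mathfrak S_n$ (i.e. the center is $\mathfrak S_n$-invariant and separates orbits).
   Context: $\mathbb N=\{1,2,3,\dots\}$, $[n]=\{1,\dots,n\}$, $\mathbf 1=(1,\dots,1)$. The $n$-dimensional $m$-Catalan arrangement consists of the hyperplanes $\{x\in\mathbb R^n: x_i-x_j=a\}$ for $1\le i<j\le n$ and integers $a\in[-m,m]$; its regions are the connected components of the complement of their union. Let $R_0$ be the region containing the points with $x_1>\dots>x_n$ and $x_1-x_n<1$. The Pak–Stanley label of a region $R$ is $\mathbf 1+\sum_H e_{c(H)}$, summed over the hyperplanes $H$ separating $R$ from $R_0$, where for $H=\{x_i-x_j=a\}$ ($i<j$), $c(H)=j$ if $a>0$ and $c(H)=i$ if $a\le0$ ($e_k$ the standard basis vector). $\pi\in\mathfrak S_n$ acts by $\pi(x_1,\dots,x_n)=(x_{\pi^{-1}(1)},\dots,x_{\pi^{-1}(n)})$, mapping regions to regions. For $\mathbf a\in\mathbb N^n$ and an integer $p$, the $p$-center $Z_p(\mathbf a)$ is the largest subset $X=\{x_1,\dots,x_q\}$ of $[n]$ with $x_q<\dots<x_1$ such that $a_{x_j}\le p+j$ for every $j\in[q]$; $z_p(\mathbf a)=|Z_p(\mathbf a)|$. The center of $\mathbf a$ is $\mathbf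 z(\mathbf a)=(z_0(\mathbf a),z_1(\mathbf a),\dots,z_{(n-1)m}(\mathbf a))$. *)

theory Defs
  imports "HOL-Analysis.Analysis" "HOL-Combinatorics.Permutations"
begin

(* The space R^n is the set of extensional functions on {1..n}. The subspace topology it
   inherits from the product topology on nat \<Rightarrow> real is the usual Euclidean one. *)
definition Rn :: "nat \<Rightarrow> (nat \<Rightarrow> real) set" where
  "Rn n = {1..n} \<rightarrow>\<^sub>E UNIV"

(* The triple (i, j, a) stands for the hyperplane x_i - x_j = a; since i < j, distinct triples
   give distinct hyperplanes, so sums over hyperplanes may be taken over triples. *)
type_synonym plane = "nat \<times> nat \<times> int"

definition catalan_planes :: "nat \<Rightarrow> nat \<Rightarrow> plane set" where
  "catalan_planes n m = {(i, j, a). 1 \<le> i \<and> i < j \<and> j \<le> n \<and> - int m \<le> a \<and> a \<le> int m}"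

definition hyperplane :: "nat \<Rightarrow> plane \<Rightarrow> (nat \<Rightarrow> real) set" where
  "hyperplane n = (\<lambda>(i, j, a). {x \<in> Rn n. x i - x j = of_int a})"

definition regions :: "nat \<Rightarrow> nat \<Rightarrow> (nat \<Rightarrow> real) set set" where
  "regions n m = components (Rn n - (\<Union>H\<in>catalan_planes n m. hyperplane n H))"

definition base_region :: "nat \<Rightarrow> nat \<Rightarrow> (nat \<Rightarrow> real) set" where
  "base_region n m =
     (THE R. R \<in> regions n m \<and>
        {x \<in> Rn n. strict_antimono_on {1..n} x \<and> x 1 - x n < 1} \<subseteq> R)"

definition separates :: "plane \<Rightarrow> (nat \<Rightarrow> real) set \<Rightarrow> (nat \<Rightarrow> real) set \<Rightarrow> bool" where
  "separates = (\<lambda>(i, j, a) A B.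
     (\<forall>x\<in>A. x i - x j < of_int a) \<and> (\<forall>y\<in>B. y i - y j > of_int a) \<or>
     (\<forall>x\<in>A. x i - x j > of_int a) \<and> (\<forall>y\<in>B. y i - y j < of_int a))"

definition ps_index :: "plane \<Rightarrow> nat" where
  "ps_index = (\<lambda>(i, j, a). if a > 0 then j else i)"

(* Only the values on {1..n} are meaningful. *)
definition pak_stanley_label :: "nat \<Rightarrow> nat \<Rightarrow> (nat \<Rightarrow> real) set \<Rightarrow> nat \<Rightarrow> nat" where
  "pak_stanley_label n m R =
     (\<lambda>k. 1 + (\<Sum>H | H \<in> catalan_planes n m \<and> separates H R (base_region n m).
                 of_bool (k = ps_index H)))"

definition perm_act :: "(nat \<Rightarrow> nat) \<Rightarrow> (nat \<Rightarrow> real) \<Rightarrow> nat \<Rightarrow> real" where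
  "perm_act \<pi> x = (\<lambda>i. x (inv \<pi> i))"

definition p_central :: "nat \<Rightarrow> int \<Rightarrow> (nat \<Rightarrow> nat) \<Rightarrow> nat set \<Rightarrow> bool" where
  "p_central n p a X \<longleftrightarrow> X \<subseteq> {1..n} \<and>
     (\<exists>q x. X = x ` {1..q} \<and> strict_antimono_on {1..q} x \<and>
        (\<forall>j\<in>{1..q}. int (a (x j)) \<le> p + int j))"

(* The largest such set is taken with respect to inclusion: it exists because p_central sets
   are closed under union (shown below), and it is also the unique one of largest cardinality. *)
definition p_center :: "nat \<Rightarrow> int \<Rightarrow> (nat \<Rightarrow> nat) \<Rightarrow> nat set" where
  "p_center n p a = (GREATEST X. p_central n p a X)"

definition center :: "nat \<Rightarrow> nat \<Rightarrow> (nat \<Rightarrow> nat) \<Rightarrow> nat list" where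
  "center n m a = map (\<lambda>p. card (p_center n p a)) [0..int ((n - 1) * m)]"

lemma p_central_iff:
  "p_central n p a X \<longleftrightarrow>
     X \<subseteq> {1..n} \<and> (\<forall>y\<in>X. int (a y) \<le> p + int (card {z \<in> X. y \<le> z}))"
proof (cases "X \<subseteq> {1..n}")
  case True
  then have fin: "finite X"
    using finite_subset by blast
  have pos: "card {z \<in> X. x j \<le> z} = j"
    if X: "X = x ` {1..q}" and x: "strict_antimono_on {1..q} x" and j: "j \<in> {1..q}" for q x j
  proof -
    have inj: "inj_on x {1..q}"
      using x by (auto simp: strict_antimono_iff_antimono)
    have "{z \<in> X. x j \<le> z} = x ` {1..j}"
    proof (intro equalityI subsetI)
      fix z assume "z \<in> {z \<in> X. x j \<le> z}"
      then obtain i where i: "i \<in> {1..q}" "z = x i" "x j \<le> x i"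
        using X by auto
      then have "i \<le> j"
        using monotone_onD[OF x, of j i] j by (cases "i \<le> j") auto
      then show "z \<in> x ` {1..j}"
        using i by auto
    next
      fix z assume "z \<in> x ` {1..j}"
      then obtain i where i: "i \<in> {1..j}" "z = x i"
        by auto
      then have "x j \<le> x i"
        using monotone_onD[OF x, of i j] j by (cases "i = j") auto
      then show "z \<in> {z \<in> X. x j \<le> z}"
        using X i j by auto
    qed
    also have "card \<dots> = j"
      using j by (subst card_image) (auto intro: inj_on_subset[OF inj])
    finally show ?thesis .
  qed
  show ?thesis
  proof
    assume "p_central n p a X"
    then obtain q x where "X = x ` {1..q}" "strict_antimono_on {1..q} x"
        "\<forall>j\<in>{1..q}. int (a (x j)) \<le> p + int j"
      unfolding p_central_def by blast
    with pos True show "X \<subseteq> {1..n} \<and> (\<forall>y\<in>X. int (a y) \<le> p + int (card {z \<in> X. y \<le> z}))"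
      by fastforce
  next
    assume R: "X \<subseteq> {1..n} \<and> (\<forall>y\<in>X. int (a y) \<le> p + int (card {z \<in> X. y \<le> z}))"
    define q where "q = card X"
    define x where "x = (\<lambda>j. sorted_list_of_set X ! (q - j))"
    have len: "length (sorted_list_of_set X) = q"
      by (simp add: q_def)
    have Xx: "X = x ` {1..q}"
    proof -
      have "X = set (sorted_list_of_set X)"
        using fin by simp
      also have "\<dots> = (\<lambda>i. sorted_list_of_set X ! i) ` {..<q}"
        unfolding set_conv_nth len by auto
      also have "{..<q} = (\<lambda>j. q - j) ` {1..q}"
      proof (intro equalityI subsetI)
        fix i assume "i \<in> {..<q}"
        then show "i \<in> (\<lambda>j. q - j) ` {1..q}"
          by (intro image_eqI[of _ _ "q - i"]) auto
      qed auto
      finally show ?thesis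
        by (simp add: x_def image_image)
    qed
    have xa: "strict_antimono_on {1..q} x"
    proof (rule monotone_onI)
      fix i j assume "i \<in> {1..q}" "j \<in> {1..q}" "i < j"
      then show "x j < x i"
        unfolding x_def using len strict_sorted_list_of_set[of X]
        by (intro sorted_wrt_nth_less[of "(<)"]) auto
    qed
    have "\<forall>j\<in>{1..q}. int (a (x j)) \<le> p + int j"
      using R pos[OF Xx xa] unfolding Xx by force
    with True Xx xa show "p_central n p a X"
      unfolding p_central_def by blast
  qed
qed (simp add: p_central_def)

lemma p_central_Union:
  assumes "\<And>X. X \<in> F \<Longrightarrow> p_central n p a X"
  shows "p_central n p a (\<Union>F)"
  unfolding p_central_iff
proof (intro conjI ballI)
  show sub: "\<Union>F \<subseteq> {1..n}"
    using assms by (auto simp: p_central_iff)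
  fix y assume "y \<in> \<Union>F"
  then obtain X where X: "X \<in> F" "y \<in> X"
    by blast
  have "card {z \<in> X. y \<le> z} \<le> card {z \<in> \<Union>F. y \<le> z}"
    using X finite_subset[OF sub]
    by (intro card_mono) (auto intro: finite_subset[of "{z \<in> \<Union>F. y \<le> z}" "\<Union>F"] simp del: Union_iff)
  moreover have "int (a y) \<le> p + int (card {z \<in> X. y \<le> z})"
    using assms[OF X(1)] X(2) by (auto simp: p_central_iff)
  ultimately show "int (a y) \<le> p + int (card {z \<in> \<Union>F. y \<le> z})"
    by linarith
qed

lemma p_center_eq_Union: "p_center n p a = \<Union>{X. p_central n p a X}"
  unfolding p_center_def by (rule Greatest_equality) (auto intro: p_central_Union)

end

(* For a point x of a region R let f x k be the number of pairs (j, b) with 1 <= b <= m and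
   x j > x k + b.  The Pak-Stanley label of R is then
   1 + f x k + #{j > k. x j > x k}, and the p-center of the label turns out to be exactly
   {k. f x k <= p}.  So the center records the multiset of values of f x, which is invariant
   under permutations.  Conversely, if the coordinates of x are decreasing, then the f x k pairs
   (j, b) counted by f x k are the top ones in the linear order of the numbers x j - b with
   j < k, and that order depends only on the region of (x 1, ..., x (k - 1)); by induction on k,
   f x determines the region of x. *)
theory Submission
  imports Defs
begin

section \<open>Regions as sign cells\<close>

text \<open>The planes of \<open>catalan_planes\<close> are regrouped by ordered pairs with a shift
  \<open>b\<close> in \<open>0..m\<close>: an offset \<open>-b\<close> is the offset
  \<open>b\<close> of the swapped pair. This form is symmetric in the indices, as the permutation
  action requires, and \<open>A\<close> is arbitrary so that an induction can pass to initial
  segments.\<close>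

definition generic_on :: "nat set \<Rightarrow> nat \<Rightarrow> (nat \<Rightarrow> real) \<Rightarrow> bool" where
  "generic_on A m x \<longleftrightarrow> (\<forall>i\<in>A. \<forall>j\<in>A. i \<noteq> j \<longrightarrow> (\<forall>b\<le>m. x i \<noteq> x j + real b))"

definition same_on :: "nat set \<Rightarrow> nat \<Rightarrow> (nat \<Rightarrow> real) \<Rightarrow> (nat \<Rightarrow> real) \<Rightarrow> bool" where
  "same_on A m x y \<longleftrightarrow>
     (\<forall>i\<in>A. \<forall>j\<in>A. \<forall>b\<le>m. x j + real b < x i \<longleftrightarrow> y j + real b < y i)"

definition catalan_complement :: "nat \<Rightarrow> nat \<Rightarrow> (nat \<Rightarrow> real) set" where
  "catalan_complement n m = {x \<in> Rn n. generic_on {1..n} m x}"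

lemma generic_on_subset: "generic_on A m x \<Longrightarrow> B \<subseteq> A \<Longrightarrow> generic_on B m x"
  unfolding generic_on_def by blast

lemma same_on_sym: "same_on A m x y \<Longrightarrow> same_on A m y x"
  unfolding same_on_def by blast

lemma same_on_trans: "same_on A m x y \<Longrightarrow> same_on A m y z \<Longrightarrow> same_on A m x z"
  unfolding same_on_def by blast

text \<open>Only the difference of \<open>b\<close> and \<open>c\<close> matters. If
  \<open>c \<le> b\<close> this is one of the comparisons in \<open>same_on\<close>; otherwise it is
  the negation of one with \<open>i\<close> and \<open>j\<close> swapped, where genericity excludes
  equality. Read as a comparison of \<open>x j - c\<close> with \<open>x i - b\<close>, it says that
  the region fixes the order of these shifted coordinates.\<close>

lemma same_on_diff_iff:
  assumes gx: "generic_on A m x" and gy: "generic_on A m y" and s: "same_on A m x y"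
    and ij: "i \<in> A" "j \<in> A" and bc: "b \<le> m" "c \<le> m"
  shows "x j + real b < x i + real c \<longleftrightarrow> y j + real b < y i + real c"
proof (cases "i = j")
  case False
  show ?thesis
  proof (cases "c \<le> b")
    case True
    then show ?thesis
      using s[unfolded same_on_def, rule_format, OF ij, of "b - c"] bc
      by (auto simp: of_nat_diff algebra_simps)
  next
    case c: False
    have "b \<le> c" "c - b \<le> m" using c bc by auto
    moreover have "x j \<noteq> x i + real (c - b)" "y j \<noteq> y i + real (c - b)"
      using gx gy ij False \<open>c - b \<le> m\<close> unfolding generic_on_def by metis+
    moreover have "x i + real (c - b) < x j \<longleftrightarrow> y i + real (c - b) < y j"
      using s ij \<open>c - b \<le> m\<close> unfolding same_on_def by blast
    ultimately show ?thesis
      by (simp add: of_nat_diff) linarith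
  qed
qed auto

lemma same_on_int_iff:
  assumes gx: "generic_on A m x" and gy: "generic_on A m y" and s: "same_on A m x y"
    and ij: "i \<in> A" "j \<in> A" and a: "- int m \<le> a" "a \<le> int m"
  shows "x i - x j > of_int a \<longleftrightarrow> y i - y j > of_int a"
    and "x i - x j < of_int a \<longleftrightarrow> y i - y j < of_int a"
proof -
  \<comment> \<open>The positive and the negative part of \<open>a\<close>, so that both stay at
    most \<open>m\<close>.\<close>
  obtain b c where bc: "b \<le> m" "c \<le> m" "a = int b - int c"
  proof (cases "0 \<le> a")
    case True
    show ?thesis by (rule that[of "nat a" 0]) (use True a in auto)
  next
    case False
    show ?thesis by (rule that[of 0 "nat (- a)"]) (use False a in auto)
  qed
  show "x i - x j > of_int a \<longleftrightarrow> y i - y j > of_int a"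
    using same_on_diff_iff[OF gx gy s ij bc(1,2)] bc(3) by auto
  show "x i - x j < of_int a \<longleftrightarrow> y i - y j < of_int a"
    using same_on_diff_iff[OF gx gy s ij(2,1) bc(2,1)] bc(3) by auto
qed

lemma catalan_complement_eq:
  "Rn n - (\<Union>H\<in>catalan_planes n m. hyperplane n H) = catalan_complement n m"
proof (intro equalityI subsetI)
  fix x assume x: "x \<in> Rn n - (\<Union>H\<in>catalan_planes n m. hyperplane n H)"
  have "x i \<noteq> x j + real b" if "i \<in> {1..n}" "j \<in> {1..n}" "i \<noteq> j" "b \<le> m" for i j b
  proof (cases "i < j")
    case True
    then have "(i, j, int b) \<in> catalan_planes n m"
      using that by (auto simp: catalan_planes_def)
    with x show ?thesis by (force simp: hyperplane_def)
  next
    case False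
    then have "(j, i, - int b) \<in> catalan_planes n m"
      using that by (auto simp: catalan_planes_def)
    with x show ?thesis by (force simp: hyperplane_def)
  qed
  with x show "x \<in> catalan_complement n m"
    by (auto simp: catalan_complement_def generic_on_def)
next
  fix x assume "x \<in> catalan_complement n m"
  then have x: "x \<in> Rn n" and g: "generic_on {1..n} m x"
    by (auto simp: catalan_complement_def)
  have "x i - x j \<noteq> of_int a" if "(i, j, a) \<in> catalan_planes n m" for i j a
  proof (cases "0 \<le> a")
    case True
    then show ?thesis
      using that g[unfolded generic_on_def, rule_format, of i j "nat a"]
      by (auto simp: catalan_planes_def nat_le_iff)
  next
    case False
    then show ?thesis
      using that g[unfolded generic_on_def, rule_format, of j i "nat (- a)"]
      by (auto simp: catalan_planes_def nat_le_iff)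
  qed
  with x show "x \<in> Rn n - (\<Union>H\<in>catalan_planes n m. hyperplane n H)"
    by (auto simp: hyperplane_def)
qed

text \<open>Intermediate value theorem: on a connected set the continuous function
  \<open>z i - z j\<close> cannot get from one side of \<open>b\<close> to the other without a point
  on the hyperplane.\<close>

lemma connected_component_complement_imp_same:
  assumes "connected_component (catalan_complement n m) x y"
  shows "same_on {1..n} m x y"
proof -
  obtain T where T: "connected T" "T \<subseteq> catalan_complement n m" "x \<in> T" "y \<in> T"
    using assms unfolding connected_component_def by blast
  have le: "v i - v j > real b"
    if "u \<in> T" "v \<in> T" "i \<in> {1..n}" "j \<in> {1..n}" "b \<le> m" "u i - u j > real b" for u v i j b
  proof (rule ccontr)
    assume neg: "\<not> v i - v j > real b"
    have "continuous_on T (\<lambda>z. z i - z j)"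
      by (intro continuous_on_diff continuous_on_subset[OF continuous_on_product_coordinates]) auto
    then have "connected ((\<lambda>z. z i - z j) ` T)"
      using T(1) connected_continuous_image by blast
    from connectedD_interval[OF this, of "v i - v j" "u i - u j" "real b"]
    have "real b \<in> (\<lambda>z. z i - z j) ` T"
      using that neg by auto
    then obtain z where z: "z \<in> T" "z i - z j = real b" by auto
    have "i \<noteq> j" using that by auto
    moreover have "generic_on {1..n} m z"
      using z T(2) by (auto simp: catalan_complement_def)
    ultimately have "z i \<noteq> z j + real b"
      using that unfolding generic_on_def by blast
    with z show False by auto
  qed
  have "x j + real b < x i \<longleftrightarrow> y j + real b < y i"
    if "i \<in> {1..n}" "j \<in> {1..n}" "b \<le> m" for i j b
    using le[OF T(3,4) that] le[OF T(4,3) that] by linarith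
  then show ?thesis
    unfolding same_on_def by blast
qed

text \<open>Cells are convex: along the segment from \<open>x\<close> to \<open>y\<close> each
  \<open>z i - z j - b\<close> is affine in the parameter and has the same nonzero sign at both
  ends, so it never vanishes.\<close>

lemma same_imp_connected_component_complement:
  assumes x: "x \<in> catalan_complement n m" and y: "y \<in> catalan_complement n m"
    and s: "same_on {1..n} m x y"
  shows "connected_component (catalan_complement n m) x y"
proof -
  have gx: "generic_on {1..n} m x" and gy: "generic_on {1..n} m y"
    using x y by (simp_all add: catalan_complement_def)
  define g where "g = (\<lambda>t::real. \<lambda>i. (1 - t) * x i + t * y i)"
  have "continuous_on {0..1} g"
    unfolding g_def
    by (rule continuous_on_coordinatewise_then_product) (intro continuous_intros)
  then have "connected (g ` {0..1})"
    by (intro connected_continuous_image) auto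
  moreover have "g 0 = x" "g 1 = y" by (auto simp: g_def)
  then have "x \<in> g ` {0..1}" "y \<in> g ` {0..1}" by force+
  moreover have "g ` {0..1} \<subseteq> catalan_complement n m"
  proof
    fix z assume "z \<in> g ` {0..1}"
    then obtain t where t: "0 \<le> t" "t \<le> 1" and z: "z = g t" by auto
    have "z \<in> Rn n"
      using x y by (auto simp: z g_def catalan_complement_def Rn_def PiE_def extensional_def
          algebra_simps)
    moreover have "z i \<noteq> z j + real b"
      if ij: "i \<in> {1..n}" "j \<in> {1..n}" "i \<noteq> j" "b \<le> m" for i j b
    proof -
      define p where "p = x i - x j - real b"
      define q where "q = y i - y j - real b"
      have ne: "p \<noteq> 0" "q \<noteq> 0"
        using gx[unfolded generic_on_def, rule_format, OF ij]
          gy[unfolded generic_on_def, rule_format, OF ij] by (auto simp: p_def q_def)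
      have pq: "0 < p \<longleftrightarrow> 0 < q"
        using s[unfolded same_on_def, rule_format, OF ij(1,2,4)] by (auto simp: p_def q_def)
      have eq: "z i - (z j + real b) = (1 - t) * p + t * q"
        by (simp add: z g_def p_def q_def algebra_simps)
      \<comment> \<open>Used for \<open>p, q\<close> and for \<open>-p, -q\<close>, which covers
        both possible common signs.\<close>
      have pos: "(1 - t) * c + t * d > 0" if "0 < c" "0 < d" for c d
      proof (cases "t = 1")
        case False
        then have "(1 - t) * c > 0" "t * d \<ge> 0" using t that by simp_all
        then show ?thesis by linarith
      qed (use that in simp)
      have "(1 - t) * p + t * q \<noteq> 0"
        using pos[of p q] pos[of "- p" "- q"] ne pq by auto
      with eq show ?thesis by auto
    qed
    ultimately show "z \<in> catalan_complement n m"
      by (simp add: catalan_complement_def generic_on_def)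
  qed
  ultimately show ?thesis
    unfolding connected_component_def by blast
qed

lemma connected_component_set_complement:
  assumes "x \<in> catalan_complement n m"
  shows "connected_component_set (catalan_complement n m) x =
    {y \<in> catalan_complement n m. same_on {1..n} m x y}"
  using assms same_imp_connected_component_complement connected_component_complement_imp_same
    connected_component_in by blast

text \<open>Any point of a region may serve as its representative; from here on regions are handled
  through one chosen point.\<close>

lemma region_eq:
  assumes R: "R \<in> regions n m" and x: "x \<in> R"
  shows "R = {y \<in> catalan_complement n m. same_on {1..n} m x y}"
    and "x \<in> catalan_complement n m"
proof -
  obtain w where w: "w \<in> catalan_complement n m"
    and Rw: "R = connected_component_set (catalan_complement n m) w"
    using R unfolding regions_def catalan_complement_eq components_def by blast
  have Req: "R = {y \<in> catalan_complement n m. same_on {1..n} m w y}"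
    unfolding Rw by (rule connected_component_set_complement[OF w])
  with x show "x \<in> catalan_complement n m" by auto
  from Req x have wx: "same_on {1..n} m w x" by auto
  have "same_on {1..n} m w y \<longleftrightarrow> same_on {1..n} m x y" for y
    using wx same_on_sym same_on_trans by metis
  with Req show "R = {y \<in> catalan_complement n m. same_on {1..n} m x y}"
    by simp
qed

lemma region_nonempty: "R \<in> regions n m \<Longrightarrow> \<exists>x. x \<in> R"
  unfolding regions_def using in_components_nonempty by blast

lemma cell_in_regions:
  assumes "x \<in> catalan_complement n m"
  shows "{y \<in> catalan_complement n m. same_on {1..n} m x y} \<in> regions n m"
  unfolding regions_def catalan_complement_eq components_def
  using assms connected_component_set_complement[OF assms] by blast

section \<open>The base region and separation from it\<close>

definition base_point :: "nat \<Rightarrow> nat \<Rightarrow> real" where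
  "base_point n = (\<lambda>k\<in>{1..n}. - (real k / real (n + 1)))"

text \<open>The denominator \<open>n + 1\<close> makes the total spread
  \<open>(n - 1) / (n + 1) < 1\<close>. The point shows that the set in the definition of
  \<open>base_region\<close> is nonempty, so at most one region can contain that set.\<close>

lemma base_point:
  "base_point n \<in> {x \<in> Rn n. strict_antimono_on {1..n} x \<and> x 1 - x n < 1}"
proof -
  have "base_point n \<in> Rn n" by (simp add: base_point_def Rn_def)
  moreover have "strict_antimono_on {1..n} (base_point n)"
    by (rule monotone_onI) (auto simp: base_point_def divide_strict_right_mono)
  moreover have "base_point n 1 - base_point n n < 1"
  proof (cases "n = 0")
    case False
    then have "base_point n 1 - base_point n n = (real n - 1) / (real n + 1)"
      by (simp add: base_point_def diff_divide_distrib add.commute)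
    also have "\<dots> < 1" by (simp add: divide_less_eq)
    finally show ?thesis .
  qed (simp add: base_point_def)
  ultimately show ?thesis by simp
qed

text \<open>For decreasing coordinates of spread below 1, every \<open>x i - x j\<close> with
  \<open>i < j\<close> lies strictly between 0 and 1. No integer does, so all such points lie on the
  same side of every hyperplane and hence in one cell.\<close>

lemma base_region:
  "base_region n m \<in> regions n m \<and>
   {x \<in> Rn n. strict_antimono_on {1..n} x \<and> x 1 - x n < 1} \<subseteq> base_region n m"
proof -
  let ?B = "{x \<in> Rn n. strict_antimono_on {1..n} x \<and> x 1 - x n < 1}"
  have lt: "0 < x i - x j \<and> x i - x j < 1"
    if x: "x \<in> ?B" and ij: "i \<in> {1..n}" "j \<in> {1..n}" "i < j" for x i j
  proof -
    have a: "strict_antimono_on {1..n} x" "x 1 - x n < 1" using x by auto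
    have "x j < x i" using monotone_onD[OF a(1) ij] .
    moreover have "x i \<le> x 1"
      using monotone_onD[OF a(1), of 1 i] ij by (cases "i = 1") auto
    moreover have "x n \<le> x j"
      using monotone_onD[OF a(1), of j n] ij by (cases "j = n") auto
    ultimately show ?thesis using a by linarith
  qed
  have iff: "x j + real b < x i \<longleftrightarrow> b = 0 \<and> i < j" "i \<noteq> j \<Longrightarrow> x i \<noteq> x j + real b"
    if x: "x \<in> ?B" and ij: "i \<in> {1..n}" "j \<in> {1..n}" for x i j b
  proof -
    have "b = 0 \<or> real b \<ge> 1" by (cases b) auto
    then show "x j + real b < x i \<longleftrightarrow> b = 0 \<and> i < j"
      using lt[OF x ij] lt[OF x ij(2,1)] by (cases i j rule: linorder_cases) auto
    show "i \<noteq> j \<Longrightarrow> x i \<noteq> x j + real b"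
      using lt[OF x ij] lt[OF x ij(2,1)] \<open>b = 0 \<or> real b \<ge> 1\<close>
      by (cases i j rule: linorder_cases) auto
  qed
  have BC: "?B \<subseteq> catalan_complement n m"
    using iff(2) by (auto simp: catalan_complement_def generic_on_def)
  have same: "same_on {1..n} m x y" if "x \<in> ?B" "y \<in> ?B" for x y
    using iff(1)[OF that(1)] iff(1)[OF that(2)] unfolding same_on_def by blast
  note pB = base_point[of n]
  let ?R = "{y \<in> catalan_complement n m. same_on {1..n} m (base_point n) y}"
  have 1: "?R \<in> regions n m \<and> ?B \<subseteq> ?R"
    using cell_in_regions[of "base_point n" n m] same[OF pB] BC pB by blast
  have 2: "R = ?R" if "R \<in> regions n m \<and> ?B \<subseteq> R" for R
    using region_eq(1)[of R n m "base_point n"] that pB by blast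
  show ?thesis
    unfolding base_region_def
    by (rule theI[where P = "\<lambda>R. R \<in> regions n m \<and> ?B \<subseteq> R", OF 1]) (rule 2)
qed

text \<open>It suffices to look at \<open>base_point\<close>, where the difference lies strictly
  between 0 and 1; \<open>same_on_int_iff\<close> carries the result to the whole region.\<close>

lemma base_region_diff:
  assumes z: "z \<in> base_region n m" and ij: "1 \<le> i" "i < j" "j \<le> n"
    and a: "- int m \<le> a" "a \<le> int m"
  shows "z i - z j < of_int a \<longleftrightarrow> 0 < a" "z i - z j > of_int a \<longleftrightarrow> a \<le> 0"
proof -
  let ?p = "base_point n"
  have p: "?p \<in> base_region n m"
    using base_region base_point by blast
  note R = base_region[of n m, THEN conjunct1]
  have zz: "generic_on {1..n} m z" "generic_on {1..n} m ?p" "same_on {1..n} m z ?p"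
    using region_eq[OF R z] region_eq(2)[OF R p] p by (auto simp: catalan_complement_def)
  have "i \<in> {1..n}" "j \<in> {1..n}" using ij by auto
  note same_on_int_iff[OF zz this a]
  moreover have "?p i - ?p j = (real j - real i) / (real n + 1)"
    using ij by (simp add: base_point_def diff_divide_distrib add.commute)
  then have d: "0 < ?p i - ?p j" "?p i - ?p j < 1"
    using ij by (simp_all add: divide_less_eq)
  have "0 < a \<Longrightarrow> 1 \<le> (of_int a :: real)" "a \<le> 0 \<Longrightarrow> of_int a \<le> (0::real)"
    by auto
  with d have "?p i - ?p j < of_int a \<longleftrightarrow> 0 < a" "?p i - ?p j > of_int a \<longleftrightarrow> a \<le> 0"
    by linarith+
  ultimately show "z i - z j < of_int a \<longleftrightarrow> 0 < a" "z i - z j > of_int a \<longleftrightarrow> a \<le> 0"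
    by blast+
qed

lemma separates_base_region_iff:
  assumes R: "R \<in> regions n m" and x: "x \<in> R" and H: "(i, j, a) \<in> catalan_planes n m"
  shows "separates (i, j, a) R (base_region n m) \<longleftrightarrow>
    (if 0 < a then x i - x j > of_int a else x i - x j < of_int a)"
proof -
  have ij: "1 \<le> i" "i < j" "j \<le> n" and a: "- int m \<le> a" "a \<le> int m"
    using H by (auto simp: catalan_planes_def)
  obtain z where z: "z \<in> base_region n m"
    using region_nonempty base_region by blast
  have ij': "i \<in> {1..n}" "j \<in> {1..n}" using ij by auto
  have y: "(y i - y j > of_int a \<longleftrightarrow> x i - x j > of_int a) \<and>
      (y i - y j < of_int a \<longleftrightarrow> x i - x j < of_int a)" if "y \<in> R" for y
  proof -
    have g: "generic_on {1..n} m x" "generic_on {1..n} m y" "same_on {1..n} m x y"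
      using region_eq[OF R x] region_eq(2)[OF R that] that by (auto simp: catalan_complement_def)
    show ?thesis
      using same_on_int_iff[OF g ij' a] by blast
  qed
  \<comment> \<open>Nonemptiness of the base region matters here: on an empty set both universal
    statements would hold.\<close>
  have zi: "(\<forall>z\<in>base_region n m. z i - z j < of_int a) \<longleftrightarrow> 0 < a"
    "(\<forall>z\<in>base_region n m. z i - z j > of_int a) \<longleftrightarrow> a \<le> 0"
    using base_region_diff[OF _ ij a] z by blast+
  have "(\<forall>y\<in>R. y i - y j > of_int a) \<longleftrightarrow> x i - x j > of_int a"
    "(\<forall>y\<in>R. y i - y j < of_int a) \<longleftrightarrow> x i - x j < of_int a"
    using x y by blast+
  with zi show ?thesis
    by (auto simp: separates_def)
qed

section \<open>Labels and centers\<close>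

text \<open>The shift starts at 1 because comparisons with \<open>b = 0\<close> enter the label only
  for \<open>k < j\<close> and are counted separately.\<close>

definition exceed :: "nat \<Rightarrow> nat \<Rightarrow> (nat \<Rightarrow> real) \<Rightarrow> nat \<Rightarrow> (nat \<times> nat) set" where
  "exceed n m x k = {(j, b). j \<in> {1..n} \<and> b \<in> {1..m} \<and> x k + real b < x j}"

lemma finite_exceed [simp]: "finite (exceed n m x k)"
  by (rule finite_subset[of _ "{1..n} \<times> {1..m}"]) (auto simp: exceed_def)

text \<open>The index \<open>j = k\<close> never occurs, since \<open>b\<close> is positive. The
  bound is the last index in \<open>center\<close>.\<close>

lemma card_exceed_le:
  assumes "k \<in> {1..n}"
  shows "card (exceed n m x k) \<le> (n - 1) * m"
proof -
  have "exceed n m x k \<subseteq> ({1..n} - {k}) \<times> {1..m}"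
    by (auto simp: exceed_def)
  then have "card (exceed n m x k) \<le> card (({1..n} - {k}) \<times> {1..m})"
    by (intro card_mono) auto
  also have "\<dots> = (n - 1) * m"
    using assms by (simp add: card_cartesian_product)
  finally show ?thesis .
qed

lemma card_exceed_antimono:
  assumes "x k \<le> x l"
  shows "card (exceed n m x l) \<le> card (exceed n m x k)"
  using assms by (intro card_mono finite_exceed) (auto simp: exceed_def)

text \<open>The separating hyperplanes of index \<open>k\<close> correspond to the pairs
  \<open>(j, b)\<close> with \<open>x k + b < x j\<close>. A plane with positive offset has
  \<open>k\<close> as its second index, one with offset at most 0 has \<open>k\<close> as its first;
  hence the shift 0 occurs only for \<open>k < j\<close>.\<close>

lemma pak_stanley_label_eq:
  assumes R: "R \<in> regions n m" and x: "x \<in> R" and k: "k \<in> {1..n}"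
  shows "pak_stanley_label n m R k =
    1 + card (exceed n m x k) + card {j \<in> {1..n}. k < j \<and> x k < x j}"
proof -
  define S where "S = {H \<in> catalan_planes n m. separates H R (base_region n m)}"
  define P where "P = {H \<in> S. k = ps_index H}"
  define J where "J = {j \<in> {1..n}. k < j \<and> x k < x j}"
  define Q where "Q = exceed n m x k \<union> (\<lambda>j. (j, 0)) ` J"
  \<comment> \<open>The hyperplane \<open>x j = x k + b\<close>, written with the smaller index
    first.\<close>
  define g where "g = (\<lambda>(j, b). if j < k then (j, k, int b) else (k, j, - int b))"
  have finS: "finite S"
    unfolding S_def
    by (rule finite_subset[of _ "{1..n} \<times> {1..n} \<times> {- int m..int m}"])
      (auto simp: catalan_planes_def)
  have sep: "(i, j, a) \<in> P \<longleftrightarrow> (i, j, a) \<in> catalan_planes n m \<and>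
      (if 0 < a then x i - x j > of_int a \<and> j = k else x i - x j < of_int a \<and> i = k)" for i j a
    using separates_base_region_iff[OF R x, of i j a] by (auto simp: P_def S_def ps_index_def)
  have "bij_betw g Q P"
  proof (rule bij_betw_imageI)
    show "inj_on g Q"
      by (auto simp: inj_on_def g_def Q_def exceed_def J_def split: if_splits)
    show "g ` Q = P"
    proof (intro equalityI subsetI)
      fix H assume "H \<in> g ` Q"
      then obtain j b where jb: "(j, b) \<in> Q" "H = g (j, b)" by auto
      then have q: "j \<in> {1..n}" "b \<le> m" "x k + real b < x j" "b = 0 \<Longrightarrow> k < j"
        by (auto simp: Q_def exceed_def J_def)
      then have "j \<noteq> k" by auto
      then show "H \<in> P"
        using q k by (auto simp: jb(2) g_def sep catalan_planes_def)
    next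
      fix H assume HP: "H \<in> P"
      obtain i j a where H: "H = (i, j, a)" by (cases H)
      show "H \<in> g ` Q"
      proof (cases "0 < a")
        case True
        then have "(i, nat a) \<in> Q" "g (i, nat a) = H"
          using HP by (auto simp: H sep Q_def exceed_def g_def catalan_planes_def)
        then show ?thesis by force
      next
        case False
        have "(j, nat (- a)) \<in> Q"
        proof (cases "a = 0")
          case True
          then show ?thesis
            using HP by (auto simp: H sep Q_def J_def catalan_planes_def)
        next
          case a: False
          then show ?thesis
            using HP False by (auto simp: H sep Q_def exceed_def catalan_planes_def)
        qed
        moreover have "g (j, nat (- a)) = H"
          using HP False by (auto simp: H sep g_def catalan_planes_def)
        ultimately show ?thesis by force
      qed
    qed
  qed
  then have "card P = card Q"
    by (simp add: bij_betw_same_card)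
  also have "\<dots> = card (exceed n m x k) + card ((\<lambda>j. (j, 0 :: nat)) ` J)"
    unfolding Q_def using finite_exceed by (rule card_Un_disjoint) (auto simp: J_def exceed_def)
  also have "card ((\<lambda>j. (j, 0 :: nat)) ` J) = card J"
    by (rule card_image) (auto simp: inj_on_def)
  finally have "card P = card (exceed n m x k) + card J" .
  moreover have "pak_stanley_label n m R k = 1 + card P"
    using finS by (simp add: pak_stanley_label_def P_def flip: S_def)
      (simp add: sum.If_cases of_bool_def Int_def)
  ultimately show ?thesis by (simp add: J_def)
qed

section \<open>Centers of labels as sublevel sets\<close>

lemma p_center_label:
  assumes a: "\<And>k. k \<in> {1..n} \<Longrightarrow>
      a k = 1 + card (exceed n m x k) + card {j \<in> {1..n}. k < j \<and> x k < x j}"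
  shows "p_center n (int p) a = {k \<in> {1..n}. card (exceed n m x k) \<le> p}"
proof -
  let ?f = "\<lambda>k. card (exceed n m x k)"
  let ?U = "{k \<in> {1..n}. ?f k \<le> p}"
  \<comment> \<open>The summand 1 of the label cancels against \<open>y\<close> itself, which is
    counted among the \<open>z\<close> with \<open>y \<le> z\<close>.\<close>
  have iff: "int (a y) \<le> int p + int (card {z \<in> X. y \<le> z}) \<longleftrightarrow>
      ?f y + card {j \<in> {1..n}. y < j \<and> x y < x j} \<le> p + card {z \<in> X. y < z}"
    if "X \<subseteq> {1..n}" "y \<in> X" for X y
  proof -
    have "{z \<in> X. y \<le> z} = insert y {z \<in> X. y < z}" using that by auto
    moreover have "finite {z \<in> X. y < z}" using that(1) by (auto intro: finite_subset)
    ultimately have "card {z \<in> X. y \<le> z} = Suc (card {z \<in> X. y < z})" by simp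
    then show ?thesis using a[of y] that by auto
  qed
  have "p_central n (int p) a ?U"
    unfolding p_central_iff
  proof (intro conjI ballI)
    fix y assume y: "y \<in> ?U"
    \<comment> \<open>Every \<open>j\<close> that raises the label of \<open>y\<close> has
      \<open>x y < x j\<close>, hence \<open>?f j \<le> ?f y \<le> p\<close>, so \<open>j\<close>
      lies in \<open>?U\<close> and raises the allowed bound by the same amount.\<close>
    have "card {j \<in> {1..n}. y < j \<and> x y < x j} \<le> card {z \<in> ?U. y < z}"
    proof (rule card_mono)
      show "{j \<in> {1..n}. y < j \<and> x y < x j} \<subseteq> {z \<in> ?U. y < z}"
      proof
        fix j assume j: "j \<in> {j \<in> {1..n}. y < j \<and> x y < x j}"
        then have "?f j \<le> ?f y" by (intro card_exceed_antimono) auto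
        with y j show "j \<in> {z \<in> ?U. y < z}" by auto
      qed
    qed auto
    with y show "int (a y) \<le> int p + int (card {z \<in> ?U. y \<le> z})"
      by (subst iff) auto
  qed auto
  moreover have "X \<subseteq> ?U" if X: "p_central n (int p) a X" for X
  proof (rule ccontr)
    assume "\<not> X \<subseteq> ?U"
    have sub: "X \<subseteq> {1..n}" using X by (simp add: p_central_iff)
    define B where "B = {z \<in> X. p < ?f z}"
    have B: "finite B" "B \<noteq> {}"
      using sub \<open>\<not> X \<subseteq> ?U\<close> by (auto simp: B_def intro: finite_subset)
    \<comment> \<open>The largest element of \<open>X\<close> that violates the bound: all later
      \<open>z\<close> in \<open>X\<close> have \<open>?f z \<le> p < ?f y\<close>, hence a larger
      coordinate. Each of them therefore also counts in the label of \<open>y\<close>, and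
      \<open>y\<close> breaks the inequality.\<close>
    define y where "y = Max B"
    have y: "y \<in> X" "p < ?f y" using Max_in[OF B] by (auto simp: y_def B_def)
    have "{z \<in> X. y < z} \<subseteq> {j \<in> {1..n}. y < j \<and> x y < x j}"
    proof
      fix z assume z: "z \<in> {z \<in> X. y < z}"
      then have "z \<notin> B" using Max_ge[OF B(1), of z] by (auto simp: y_def)
      then have "?f z < ?f y" using z y by (auto simp: B_def)
      then have "x y < x z"
        using card_exceed_antimono[of x z y n m] by (meson linorder_not_le)
      with z sub show "z \<in> {j \<in> {1..n}. y < j \<and> x y < x j}" by auto
    qed
    then have "card {z \<in> X. y < z} \<le> card {j \<in> {1..n}. y < j \<and> x y < x j}"
      by (intro card_mono) auto
    moreover have "int (a y) \<le> int p + int (card {z \<in> X. y \<le> z})"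
      using X y by (auto simp: p_central_iff)
    ultimately show False
      using iff[OF sub y(1)] y(2) by linarith
  qed
  ultimately show ?thesis
    unfolding p_center_eq_Union by blast
qed

text \<open>The entries of the center are the cumulative counts of the values
  \<open>card (exceed n m x k)\<close>. Beyond the last entry all \<open>n\<close> indices are
  counted on both sides, so \<open>p\<close> may range over all naturals; the condition then says
  that the multisets of values agree.\<close>

lemma center_label_eq_iff:
  assumes R: "R \<in> regions n m" "x \<in> R" and R': "R' \<in> regions n m" "y \<in> R'"
  shows "center n m (pak_stanley_label n m R) = center n m (pak_stanley_label n m R') \<longleftrightarrow>
    (\<forall>p. card {k \<in> {1..n}. card (exceed n m x k) \<le> p} =
         card {k \<in> {1..n}. card (exceed n m y k) \<le> p})"
    (is "?L \<longleftrightarrow> (\<forall>p. ?c x p = ?c y p)")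
proof -
  have c: "card (p_center n (int p) (pak_stanley_label n m R)) = ?c x p"
    "card (p_center n (int p) (pak_stanley_label n m R')) = ?c y p" for p
    by (subst p_center_label[OF pak_stanley_label_eq[OF R]]
        p_center_label[OF pak_stanley_label_eq[OF R']]; simp)+
  have "?L \<longleftrightarrow> (\<forall>p\<in>{0..int ((n - 1) * m)}.
      card (p_center n p (pak_stanley_label n m R)) =
      card (p_center n p (pak_stanley_label n m R')))"
    unfolding center_def map_eq_conv by simp
  also have "\<dots> \<longleftrightarrow> (\<forall>p\<le>(n - 1) * m. ?c x p = ?c y p)"
  proof (intro iffI allI impI ballI)
    fix p assume *: "\<forall>p\<in>{0..int ((n - 1) * m)}.
      card (p_center n p (pak_stanley_label n m R)) =
      card (p_center n p (pak_stanley_label n m R'))" and "p \<le> (n - 1) * m"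
    then have "int p \<in> {0..int ((n - 1) * m)}"
      unfolding atLeastAtMost_iff of_nat_le_iff by simp
    then show "?c x p = ?c y p"
      unfolding c[symmetric] using * by blast
  next
    fix p assume *: "\<forall>p\<le>(n - 1) * m. ?c x p = ?c y p" and p: "p \<in> {0..int ((n - 1) * m)}"
    then obtain q where q: "p = int q"
      unfolding atLeastAtMost_iff using nonneg_int_cases by blast
    then have "q \<le> (n - 1) * m"
      using p unfolding atLeastAtMost_iff by linarith
    with * show "card (p_center n p (pak_stanley_label n m R)) =
      card (p_center n p (pak_stanley_label n m R'))"
      unfolding q c by blast
  qed
  also have "\<dots> \<longleftrightarrow> (\<forall>p. ?c x p = ?c y p)"
  proof (intro iffI allI impI)
    fix p assume *: "\<forall>p\<le>(n - 1) * m. ?c x p = ?c y p"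
    show "?c x p = ?c y p"
    proof (cases "p \<le> (n - 1) * m")
      case False
      then have "(n - 1) * m \<le> p" by (simp only: not_le less_imp_le)
      then have "{k \<in> {1..n}. card (exceed n m w k) \<le> p} = {1..n}" for w
        using card_exceed_le[of _ n m w, THEN le_trans] by blast
      then show ?thesis by simp
    next
      case True
      with * show ?thesis by blast
    qed
  qed auto
  finally show ?thesis .
qed

section \<open>Decreasing points\<close>

text \<open>Adding the coordinates one at a time, in decreasing order: the set \<open>exceed\<close>
  of the new index is an upper set in the order of the earlier shifted coordinates. This order is
  already common to \<open>u\<close> and \<open>v\<close>, so the cardinality determines the
  set.\<close>

lemma same_on_if_card_exceed_eq:
  assumes gu: "generic_on {1..n} m u" and gv: "generic_on {1..n} m v"
    and du: "strict_antimono_on {1..n} u" and dv: "strict_antimono_on {1..n} v"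
    and eq: "\<And>k. k \<in> {1..n} \<Longrightarrow> card (exceed n m u k) = card (exceed n m v k)"
  shows "same_on {1..n} m u v"
proof -
  have "same_on {1..k} m u v" if "k \<le> n" for k
    using that
  proof (induction k)
    case 0
    then show ?case by (simp add: same_on_def)
  next
    case (Suc k)
    have K: "Suc k \<in> {1..n}" and s: "same_on {1..k} m u v" using Suc by auto
    have less: "w i > w (Suc k)" if "strict_antimono_on {1..n} w" "i \<in> {1..k}" for w :: "nat \<Rightarrow> real" and i
      using monotone_onD[OF that(1), of i "Suc k"] that(2) K by auto
    \<comment> \<open>Only earlier indices can exceed the new coordinate, so the induction
      hypothesis governs all pairs involved.\<close>
    have sub: "i \<in> {1..k} \<and> 1 \<le> b \<and> b \<le> m \<and> w (Suc k) + real b < w i"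
      if w: "strict_antimono_on {1..n} w" and ib: "(i, b) \<in> exceed n m w (Suc k)"
      for w :: "nat \<Rightarrow> real" and i b
    proof -
      have "\<not> Suc k < i" using monotone_onD[OF w, of "Suc k" i] K ib by (auto simp: exceed_def)
      moreover have "i \<noteq> Suc k" using ib by (auto simp: exceed_def)
      ultimately show ?thesis using ib by (auto simp: exceed_def)
    qed
    have g: "generic_on {1..k} m u" "generic_on {1..k} m v"
      using gu gv Suc.prems by (auto elim!: generic_on_subset)
    \<comment> \<open>If neither set contained the other, there would be pairs with
      \<open>u j - c \<le> u (Suc k) < u i - b\<close> and
      \<open>v i - b \<le> v (Suc k) < v j - c\<close>, that is, in opposite orders for
      \<open>u\<close> and \<open>v\<close>.\<close>
    have nest: "exceed n m u (Suc k) \<subseteq> exceed n m v (Suc k) \<or>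
        exceed n m v (Suc k) \<subseteq> exceed n m u (Suc k)"
    proof (rule ccontr)
      assume "\<not> ?thesis"
      then obtain i b j c where
        ib: "(i, b) \<in> exceed n m u (Suc k)" "(i, b) \<notin> exceed n m v (Suc k)" and
        jc: "(j, c) \<in> exceed n m v (Suc k)" "(j, c) \<notin> exceed n m u (Suc k)"
        by (meson subrelI)
      note i = sub[OF du ib(1)] and j = sub[OF dv jc(1)]
      have "v i \<le> v (Suc k) + real b" "u j \<le> u (Suc k) + real c"
        using ib jc by (auto simp: exceed_def)
      with i j have "u j + real b < u i + real c" "\<not> v j + real b < v i + real c" by linarith+
      with same_on_diff_iff[OF g s, of i j b c] i j show False by blast
    qed
    then have E: "exceed n m u (Suc k) = exceed n m v (Suc k)"
      using eq[OF K] by (metis card_subset_eq finite_exceed)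
    have top: "u (Suc k) + real b < u i \<longleftrightarrow> v (Suc k) + real b < v i"
      if "i \<in> {1..k}" "b \<le> m" for i b
    proof (cases "b = 0")
      case True
      then show ?thesis using less[OF du that(1)] less[OF dv that(1)] by simp
    next
      case False
      then have "(i, b) \<in> exceed n m w (Suc k) \<longleftrightarrow> w (Suc k) + real b < w i" for w
        using that K by (auto simp: exceed_def)
      with E show ?thesis by metis
    qed
    show ?case
      unfolding same_on_def
    proof (intro ballI allI impI)
      fix i j b assume ij: "i \<in> {1..Suc k}" "j \<in> {1..Suc k}" and b: "b \<le> m"
      consider "i \<in> {1..k}" "j \<in> {1..k}" | "i \<in> {1..k}" "j = Suc k"
        | "i = Suc k" "j \<in> {1..k}" | "i = Suc k" "j = Suc k"
        using ij by fastforce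
      then show "u j + real b < u i \<longleftrightarrow> v j + real b < v i"
      proof cases
        case 1
        then show ?thesis using s b by (auto simp: same_on_def)
      next
        case 2
        then show ?thesis using top b by auto
      next
        case 3
        then show ?thesis using less[OF du, of j] less[OF dv, of j] by auto
      qed auto
    qed
  qed
  then show ?thesis by blast
qed

text \<open>For decreasing coordinates the values increase weakly with \<open>k\<close>, so every
  sublevel set is an initial segment: the value at \<open>k\<close> is at most \<open>p\<close>
  exactly when that segment has at least \<open>k\<close> elements.\<close>

lemma card_exceed_eq_if_counts_eq:
  assumes du: "strict_antimono_on {1..n} u" and dv: "strict_antimono_on {1..n} v"
    and eq: "\<And>p. card {k \<in> {1..n}. card (exceed n m u k) \<le> p} =
      card {k \<in> {1..n}. card (exceed n m v k) \<le> p}"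
    and k: "k \<in> {1..n}"
  shows "card (exceed n m u k) = card (exceed n m v k)"
proof -
  have iff: "card (exceed n m w k) \<le> p \<longleftrightarrow> k \<le> card {k \<in> {1..n}. card (exceed n m w k) \<le> p}"
    if w: "strict_antimono_on {1..n} w" for w p
  proof -
    let ?S = "{k \<in> {1..n}. card (exceed n m w k) \<le> p}"
    have mono: "card (exceed n m w i) \<le> card (exceed n m w j)"
      if "i \<in> {1..n}" "j \<in> {1..n}" "i \<le> j" for i j
      using monotone_onD[OF w that(1,2)] that(3)
      by (intro card_exceed_antimono) (cases "i = j"; simp)
    show ?thesis
    proof
      assume p: "card (exceed n m w k) \<le> p"
      have "{1..k} \<subseteq> ?S"
        using mono[OF _ k] k p by force
      then have "card {1..k} \<le> card ?S" by (intro card_mono) auto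
      then show "k \<le> card ?S" by simp
    next
      assume le: "k \<le> card ?S"
      show "card (exceed n m w k) \<le> p"
      proof (rule ccontr)
        assume p: "\<not> ?thesis"
        have "?S \<subseteq> {1..<k}"
        proof
          fix i assume i: "i \<in> ?S"
          then have "\<not> k \<le> i" using mono[OF k, of i] p by auto
          with i show "i \<in> {1..<k}" by auto
        qed
        then have "card ?S \<le> card {1..<k}" by (intro card_mono) auto
        then have "card ?S \<le> k - 1" by simp
        moreover have "1 \<le> k" using k by simp
        ultimately show False using le by linarith
      qed
    qed
  qed
  have "card (exceed n m u k) \<le> p \<longleftrightarrow> card (exceed n m v k) \<le> p" for p
    unfolding iff[OF du] iff[OF dv] eq ..
  then show ?thesis by (meson order_antisym order_refl)
qed

text \<open>The rank of \<open>x k\<close> counted from the top is a bijection of the indices, and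
  its inverse sorts \<open>x\<close>.\<close>

lemma ex_sorting_permutation:
  fixes x :: "nat \<Rightarrow> real"
  assumes inj: "inj_on x {1..n}"
  shows "\<exists>\<sigma>. \<sigma> permutes {1..n} \<and> strict_antimono_on {1..n} (x \<circ> \<sigma>)"
proof -
  \<comment> \<open>The identity outside \<open>{1..n}\<close> is what \<open>permutes\<close>
    demands.\<close>
  define r where "r = (\<lambda>k. if k \<in> {1..n} then card {j \<in> {1..n}. x k \<le> x j} else k)"
  have lt: "r k < r l" if "k \<in> {1..n}" "l \<in> {1..n}" "x l < x k" for k l
  proof -
    have "{j \<in> {1..n}. x k \<le> x j} \<subseteq> {j \<in> {1..n}. x l \<le> x j}" using that by auto
    moreover have "l \<in> {j \<in> {1..n}. x l \<le> x j} - {j \<in> {1..n}. x k \<le> x j}" using that by auto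
    ultimately have "{j \<in> {1..n}. x k \<le> x j} \<subset> {j \<in> {1..n}. x l \<le> x j}" by blast
    then have "card {j \<in> {1..n}. x k \<le> x j} < card {j \<in> {1..n}. x l \<le> x j}"
      by (intro psubset_card_mono) simp_all
    with that(1,2) show ?thesis by (simp only: r_def if_True)
  qed
  have "inj_on r {1..n}"
  proof (rule inj_onI)
    fix k l assume kl: "k \<in> {1..n}" "l \<in> {1..n}" "r k = r l"
    then have "x k = x l" using lt[OF kl(1,2)] lt[OF kl(2,1)] by (metis less_irrefl linorder_neqE)
    with inj kl show "k = l" by (auto dest: inj_onD)
  qed
  moreover have "r ` {1..n} \<subseteq> {1..n}"
  proof
    fix l assume "l \<in> r ` {1..n}"
    then obtain k where k: "k \<in> {1..n}" "l = card {j \<in> {1..n}. x k \<le> x j}"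
      by (auto simp: r_def)
    have "card {j \<in> {1..n}. x k \<le> x j} \<le> card {1..n}" by (intro card_mono) auto
    moreover have "card {j \<in> {1..n}. x k \<le> x j} > 0"
      using k(1) by (auto simp: card_gt_0_iff)
    ultimately show "l \<in> {1..n}" unfolding k(2) by simp
  qed
  ultimately have "bij_betw r {1..n} {1..n}"
    by (simp add: bij_betw_def endo_inj_surj)
  then have r: "r permutes {1..n}"
    by (rule bij_imp_permutes) (simp add: r_def del: atLeastAtMost_iff)
  have "strict_antimono_on {1..n} (x \<circ> inv r)"
  proof (rule monotone_onI)
    fix i j :: nat assume ij: "i \<in> {1..n}" "j \<in> {1..n}" "i < j"
    have m: "inv r i \<in> {1..n}" "inv r j \<in> {1..n}"
      using permutes_in_image[OF permutes_inv[OF r]] ij by blast+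
    have ri: "r (inv r i) = i" "r (inv r j) = j" using permutes_inverses(1)[OF r] by auto
    then have "inv r i \<noteq> inv r j" using ij by auto
    then have "x (inv r i) \<noteq> x (inv r j)" using inj m by (auto dest: inj_onD)
    moreover have "\<not> x (inv r i) < x (inv r j)"
      using lt[OF m(2,1)] ri ij by auto
    ultimately show "(x \<circ> inv r) j < (x \<circ> inv r) i" by simp
  qed
  with permutes_inv[OF r] show ?thesis by blast
qed

section \<open>The action of permutations\<close>

lemma generic_on_permute:
  assumes "\<pi> permutes {1..n}" "generic_on {1..n} m x"
  shows "generic_on {1..n} m (x \<circ> \<pi>)"
  using assms permutes_in_image[OF assms(1)] permutes_inj[OF assms(1)]
  unfolding generic_on_def by (simp add: inj_eq del: atLeastAtMost_iff)

lemma same_on_permute: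
  assumes "\<pi> permutes {1..n}" "same_on {1..n} m x y"
  shows "same_on {1..n} m (x \<circ> \<pi>) (y \<circ> \<pi>)"
  using assms permutes_in_image[OF assms(1)]
  unfolding same_on_def by (simp del: atLeastAtMost_iff)

text \<open>A permutation of \<open>{1..n}\<close> fixes all other indices, so the composite stays
  extensional and remains in \<open>Rn n\<close>.\<close>

lemma catalan_complement_permute:
  assumes "\<pi> permutes {1..n}" "x \<in> catalan_complement n m"
  shows "x \<circ> \<pi> \<in> catalan_complement n m"
  using assms generic_on_permute[OF assms(1), of m x] permutes_not_in[OF assms(1)]
  by (auto simp: catalan_complement_def Rn_def PiE_def extensional_def simp del: atLeastAtMost_iff)

text \<open>The action is precomposition with \<open>inv \<pi>\<close>, which preserves the relation
  between cells; precomposition with \<open>\<pi>\<close> undoes it and gives the reverse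
  inclusion.\<close>

lemma perm_act_image_region:
  assumes \<pi>: "\<pi> permutes {1..n}" and R: "R \<in> regions n m" and x: "x \<in> R"
  shows "perm_act \<pi> ` R = {z \<in> catalan_complement n m. same_on {1..n} m (x \<circ> inv \<pi>) z}"
proof -
  note \<pi>' = permutes_inv[OF \<pi>]
  have act: "perm_act \<pi> w = w \<circ> inv \<pi>" for w by (simp add: perm_act_def o_def)
  note Req = region_eq(1)[OF R x]
  show ?thesis
  proof (intro equalityI subsetI)
    fix z assume "z \<in> perm_act \<pi> ` R"
    then obtain w where w: "w \<in> R" "z = w \<circ> inv \<pi>" by (auto simp: act)
    with Req show "z \<in> {z \<in> catalan_complement n m. same_on {1..n} m (x \<circ> inv \<pi>) z}"
      using catalan_complement_permute[OF \<pi>'] same_on_permute[OF \<pi>'] by blast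
  next
    fix z assume z: "z \<in> {z \<in> catalan_complement n m. same_on {1..n} m (x \<circ> inv \<pi>) z}"
    then have "z \<circ> \<pi> \<in> catalan_complement n m" "same_on {1..n} m (x \<circ> inv \<pi> \<circ> \<pi>) (z \<circ> \<pi>)"
      using catalan_complement_permute[OF \<pi>] same_on_permute[OF \<pi>] by blast+
    then have "z \<circ> \<pi> \<in> R"
      using Req by (simp add: o_assoc[symmetric] permutes_inv_o[OF \<pi>])
    moreover have "z = perm_act \<pi> (z \<circ> \<pi>)"
      by (simp add: act o_assoc[symmetric] permutes_inv_o[OF \<pi>])
    ultimately show "z \<in> perm_act \<pi> ` R" by blast
  qed
qed

text \<open>Applying \<open>\<pi>\<close> to the first component of each pair matches the two
  sets.\<close>

lemma card_exceed_permute: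
  assumes \<pi>: "\<pi> permutes {1..n}"
  shows "card (exceed n m (x \<circ> \<pi>) k) = card (exceed n m x (\<pi> k))"
proof -
  have "bij_betw (map_prod \<pi> id) (exceed n m (x \<circ> \<pi>) k) (exceed n m x (\<pi> k))"
    unfolding bij_betw_def
  proof
    show "inj_on (map_prod \<pi> id) (exceed n m (x \<circ> \<pi>) k)"
      using prod.inj_map[OF permutes_inj[OF \<pi>] inj_on_id] by (rule inj_on_subset) simp
    show "map_prod \<pi> id ` exceed n m (x \<circ> \<pi>) k = exceed n m x (\<pi> k)"
    proof (intro equalityI subsetI)
      fix q assume "q \<in> exceed n m x (\<pi> k)"
      then obtain j b where q: "q = (j, b)" "j \<in> {1..n}" "b \<in> {1..m}" "x (\<pi> k) + real b < x j"
        by (auto simp: exceed_def)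
      have "inv \<pi> j \<in> {1..n}"
        using q(2) permutes_in_image[OF permutes_inv[OF \<pi>]] by blast
      then have "(inv \<pi> j, b) \<in> exceed n m (x \<circ> \<pi>) k"
        using q permutes_inverses(1)[OF \<pi>] by (simp add: exceed_def)
      moreover have "q = map_prod \<pi> id (inv \<pi> j, b)"
        using q permutes_inverses(1)[OF \<pi>] by simp
      ultimately show "q \<in> map_prod \<pi> id ` exceed n m (x \<circ> \<pi>) k" by blast
    qed (use permutes_in_image[OF \<pi>] in \<open>auto simp: exceed_def simp del: atLeastAtMost_iff\<close>)
  qed
  then show ?thesis by (rule bij_betw_same_card)
qed

lemma exceed_counts_permute:
  assumes \<pi>: "\<pi> permutes {1..n}"
  shows "card {k \<in> {1..n}. card (exceed n m (x \<circ> \<pi>) k) \<le> p} =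
    card {k \<in> {1..n}. card (exceed n m x k) \<le> p}"
proof -
  have "bij_betw \<pi> {k \<in> {1..n}. card (exceed n m x (\<pi> k)) \<le> p}
      {k \<in> {1..n}. card (exceed n m x k) \<le> p}"
    by (rule bij_betw_Collect[OF permutes_imp_bij[OF \<pi>]]) simp
  then show ?thesis
    by (simp add: card_exceed_permute[OF \<pi>] bij_betw_same_card)
qed

section \<open>Centers separate the orbits\<close>

lemma generic_on_inj_on: "generic_on A m x \<Longrightarrow> inj_on x A"
  unfolding generic_on_def inj_on_def by (metis add.right_neutral of_nat_0 zero_le)

theorem mainTheorem3:
  fixes n m :: nat and R R' :: "(nat \<Rightarrow> real) set" and a b :: "nat \<Rightarrow> nat"
  assumes "n \<ge> 1" and "m \<ge> 1"
    and "R \<in> regions n m" and "R' \<in> regions n m"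
    and "a = pak_stanley_label n m R" and "b = pak_stanley_label n m R'"
  shows "center n m a = center n m b \<longleftrightarrow>
         (\<exists>\<pi>. \<pi> permutes {1..n} \<and> R' = perm_act \<pi> ` R)"
proof
  note R = assms(3) and R' = assms(4)
  assume eq: "center n m a = center n m b"
  obtain x y where x: "x \<in> R" and y: "y \<in> R'"
    using region_nonempty R R' by blast
  have gx: "generic_on {1..n} m x" and gy: "generic_on {1..n} m y"
    using region_eq(2)[OF R x] region_eq(2)[OF R' y] by (auto simp: catalan_complement_def)
  \<comment> \<open>Both representatives are sorted. Sorting leaves the counts unchanged, so equal
    centers force the sorted points into the same cell.\<close>
  obtain \<sigma> where \<sigma>: "\<sigma> permutes {1..n}" "strict_antimono_on {1..n} (x \<circ> \<sigma>)"
    using ex_sorting_permutation generic_on_inj_on[OF gx] by blast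
  obtain \<tau> where \<tau>: "\<tau> permutes {1..n}" "strict_antimono_on {1..n} (y \<circ> \<tau>)"
    using ex_sorting_permutation generic_on_inj_on[OF gy] by blast
  have "card (exceed n m (x \<circ> \<sigma>) k) = card (exceed n m (y \<circ> \<tau>) k)" if "k \<in> {1..n}" for k
    using eq[unfolded assms(5,6) center_label_eq_iff[OF R x R' y]]
    by (intro card_exceed_eq_if_counts_eq[OF \<sigma>(2) \<tau>(2) _ that])
      (simp only: exceed_counts_permute[OF \<sigma>(1)] exceed_counts_permute[OF \<tau>(1)])
  then have "same_on {1..n} m (x \<circ> \<sigma>) (y \<circ> \<tau>)"
    using same_on_if_card_exceed_eq generic_on_permute[OF \<sigma>(1) gx] generic_on_permute[OF \<tau>(1) gy]
      \<sigma>(2) \<tau>(2) by blast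
  from same_on_permute[OF permutes_inv[OF \<tau>(1)] this]
  have s: "same_on {1..n} m (x \<circ> (\<sigma> \<circ> inv \<tau>)) y"
    by (simp add: o_assoc[symmetric] permutes_inv_o[OF \<tau>(1)])
  \<comment> \<open>First undo the sorting of \<open>x\<close>, then apply the one of
    \<open>y\<close>: chosen so that \<open>inv \<pi> = \<sigma> \<circ> inv \<tau>\<close>, the
    composite appearing in \<open>s\<close>.\<close>
  define \<pi> where "\<pi> = \<tau> \<circ> inv \<sigma>"
  have \<pi>: "\<pi> permutes {1..n}"
    unfolding \<pi>_def by (intro permutes_compose permutes_inv \<sigma> \<tau>)
  have "inv \<pi> = \<sigma> \<circ> inv \<tau>"
    unfolding \<pi>_def
    by (subst o_inv_distrib[OF permutes_bij[OF \<tau>(1)] permutes_bij[OF permutes_inv[OF \<sigma>(1)]]])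
      (subst permutes_inv_inv[OF \<sigma>(1)], rule refl)
  with s have s: "same_on {1..n} m (x \<circ> inv \<pi>) y" by simp
  have "same_on {1..n} m y z \<longleftrightarrow> same_on {1..n} m (x \<circ> inv \<pi>) z" for z
    using s same_on_sym same_on_trans by metis
  then have "R' = perm_act \<pi> ` R"
    unfolding perm_act_image_region[OF \<pi> R x] by (subst region_eq(1)[OF R' y]) simp
  with \<pi> show "\<exists>\<pi>. \<pi> permutes {1..n} \<and> R' = perm_act \<pi> ` R" by blast
next
  note R = assms(3) and R' = assms(4)
  assume "\<exists>\<pi>. \<pi> permutes {1..n} \<and> R' = perm_act \<pi> ` R"
  then obtain \<pi> where \<pi>: "\<pi> permutes {1..n}" and Req: "R' = perm_act \<pi> ` R" by blast
  obtain x where x: "x \<in> R" using region_nonempty R by blast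
  \<comment> \<open>The image of \<open>x\<close> represents \<open>R'\<close>, so both centers are
    read off from the same coordinates up to order.\<close>
  have y: "x \<circ> inv \<pi> \<in> R'"
    using Req x by (auto simp: perm_act_def o_def)
  show "center n m a = center n m b"
    unfolding assms(5,6) center_label_eq_iff[OF R x R' y]
    unfolding exceed_counts_permute[OF permutes_inv[OF \<pi>]] by blast
qed

end
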